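(* Let $R$ be a ring, $M$ a right $R$-module and $N$ a coclosed submodule of $M$. If $M$ is simple-direct-injective, then $N$ is simple-direct-injective. The converse is true if $\mathrm{soc}(M)\subseteq N$; that is, if $\mathrm{soc}(M)\subseteq N$ and $N$ is simple-direct-injective, then $M$ is simple-direct-injective.
   Context: Rings are associative with unity and modules are unitary. A module $M$ is simple-direct-injective if, whenever $A$ and $B$ are simple submodules of $M$ with $A\cong B$ and $B$ a direct summand of $M$, then $A$ is a direct summand of $M$. A submodule $K$ of $M$ is small, written $K\ll M$, if $K+X=M$ implies $X=M$ for each submodule $X\subseteq M$. A submodule $L$ of $M$ is coclosed in $M$ if, for each submodule $K$ of $L$, $L/K\ll M/K$ implies $K=L$. $\mathrm{soc}(M)$ is the sum of all simple submodules of $M$. *)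

theory Defs
  imports "HOL-Algebra.QuotRing"
begin

text \<open>
  The module theory of HOL-Algebra is restricted to commutative base rings, so right modules over
  arbitrary unital rings are set up here in the same style. As in HOL-Algebra, the module
  record extends the record \<open>ring\<close> only to obtain the additive structure; its fields
  \<open>mult\<close> and \<open>one\<close> are never referred to.
\<close>

record ('a, 'b) right_module = "'b ring" +
  rsmult :: "'b \<Rightarrow> 'a \<Rightarrow> 'b" (infixl \<open>\<cdot>\<index>\<close> 70)

locale right_module = R?: ring R + M?: abelian_group M
  for R :: "('a, 'r) ring_scheme" (structure)
    and M :: "('a, 'b, 'm) right_module_scheme" (structure) +
  assumes rsmult_closed [simp, intro]:
      "\<lbrakk>x \<in> carrier M; a \<in> carrier R\<rbrakk> \<Longrightarrow> x \<cdot>\<^bsub>M\<^esub> a \<in> carrier M"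
    and rsmult_r_distr:
      "\<lbrakk>x \<in> carrier M; a \<in> carrier R; b \<in> carrier R\<rbrakk> \<Longrightarrow>
        x \<cdot>\<^bsub>M\<^esub> (a \<oplus>\<^bsub>R\<^esub> b) = x \<cdot>\<^bsub>M\<^esub> a \<oplus>\<^bsub>M\<^esub> x \<cdot>\<^bsub>M\<^esub> b"
    and rsmult_l_distr:
      "\<lbrakk>x \<in> carrier M; y \<in> carrier M; a \<in> carrier R\<rbrakk> \<Longrightarrow>
        (x \<oplus>\<^bsub>M\<^esub> y) \<cdot>\<^bsub>M\<^esub> a = x \<cdot>\<^bsub>M\<^esub> a \<oplus>\<^bsub>M\<^esub> y \<cdot>\<^bsub>M\<^esub> a"
    and rsmult_assoc:
      "\<lbrakk>x \<in> carrier M; a \<in> carrier R; b \<in> carrier R\<rbrakk> \<Longrightarrow>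
        x \<cdot>\<^bsub>M\<^esub> (a \<otimes>\<^bsub>R\<^esub> b) = (x \<cdot>\<^bsub>M\<^esub> a) \<cdot>\<^bsub>M\<^esub> b"
    and rsmult_one [simp]:
      "x \<in> carrier M \<Longrightarrow> x \<cdot>\<^bsub>M\<^esub> \<one>\<^bsub>R\<^esub> = x"

text \<open>
  A submodule is a subset of the carrier of \<open>M\<close>; regarded as a module in its own right,
  the submodule \<open>N\<close> is \<open>M\<lparr>carrier := N\<rparr>\<close>.
\<close>

locale right_submodule = subgroup H "add_monoid M"
  for H and R :: "('a, 'r) ring_scheme"
    and M :: "('a, 'b, 'm) right_module_scheme" (structure) +
  assumes rsmult_closed [simp, intro]:
    "\<lbrakk>x \<in> H; a \<in> carrier R\<rbrakk> \<Longrightarrow> x \<cdot>\<^bsub>M\<^esub> a \<in> H"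

definition right_module_iso ::
    "('a, 'r) ring_scheme \<Rightarrow> ('a, 'b, 'm) right_module_scheme \<Rightarrow>
      ('a, 'c, 'n) right_module_scheme \<Rightarrow> ('b \<Rightarrow> 'c) set" where
  "right_module_iso R M N =
    {f. bij_betw f (carrier M) (carrier N) \<and>
        (\<forall>x\<in>carrier M. \<forall>y\<in>carrier M. f (x \<oplus>\<^bsub>M\<^esub> y) = f x \<oplus>\<^bsub>N\<^esub> f y) \<and>
        (\<forall>x\<in>carrier M. \<forall>a\<in>carrier R. f (x \<cdot>\<^bsub>M\<^esub> a) = f x \<cdot>\<^bsub>N\<^esub> a)}"

definition simple_right_module ::
    "('a, 'r) ring_scheme \<Rightarrow> ('a, 'b, 'm) right_module_scheme \<Rightarrow> bool" where
  "simple_right_module R M \<longleftrightarrow>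
    right_module R M \<and> carrier M \<noteq> {\<zero>\<^bsub>M\<^esub>} \<and>
    (\<forall>K. right_submodule K R M \<longrightarrow> K = {\<zero>\<^bsub>M\<^esub>} \<or> K = carrier M)"

definition simple_submodule ::
    "'b set \<Rightarrow> ('a, 'r) ring_scheme \<Rightarrow> ('a, 'b, 'm) right_module_scheme \<Rightarrow> bool" where
  "simple_submodule A R M \<longleftrightarrow>
    right_submodule A R M \<and> simple_right_module R (M\<lparr>carrier := A\<rparr>)"

definition direct_summand ::
    "'b set \<Rightarrow> ('a, 'r) ring_scheme \<Rightarrow> ('a, 'b, 'm) right_module_scheme \<Rightarrow> bool" where
  "direct_summand A R M \<longleftrightarrow>
    right_submodule A R M \<and>
    (\<exists>C. right_submodule C R M \<and> A <+>\<^bsub>M\<^esub> C = carrier M \<and> A \<inter> C = {\<zero>\<^bsub>M\<^esub>})"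

definition simple_direct_injective ::
    "('a, 'r) ring_scheme \<Rightarrow> ('a, 'b, 'm) right_module_scheme \<Rightarrow> bool" where
  "simple_direct_injective R M \<longleftrightarrow>
    (\<forall>A B. simple_submodule A R M \<and> simple_submodule B R M \<and>
       right_module_iso R (M\<lparr>carrier := A\<rparr>) (M\<lparr>carrier := B\<rparr>) \<noteq> {} \<and>
       direct_summand B R M \<longrightarrow>
       direct_summand A R M)"

definition small_submodule ::
    "'b set \<Rightarrow> ('a, 'r) ring_scheme \<Rightarrow> ('a, 'b, 'm) right_module_scheme \<Rightarrow> bool" where
  "small_submodule K R M \<longleftrightarrow>
    right_submodule K R M \<and>
    (\<forall>X. right_submodule X R M \<and> K <+>\<^bsub>M\<^esub> X = carrier M \<longrightarrow> X = carrier M)"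

text \<open>
  The quotient \<open>M/K\<close> is formed as in \<^const>\<open>FactRing\<close>. The ring multiplication
  and unit are irrelevant for modules and get dummy values.
\<close>

definition quotient_module ::
    "('a, 'b, 'm) right_module_scheme \<Rightarrow> 'b set \<Rightarrow> ('a, 'b set) right_module" where
  "quotient_module M K =
    \<lparr>carrier = a_rcosets\<^bsub>M\<^esub> K, mult = (\<lambda>_ _. K), one = K,
     zero = K, add = set_add M,
     rsmult = (\<lambda>X a. \<Union>x\<in>X. K +>\<^bsub>M\<^esub> (x \<cdot>\<^bsub>M\<^esub> a))\<rparr>"

text \<open>The submodule \<open>L/K\<close> of \<open>M/K\<close> is the set of cosets of \<open>K\<close> in \<open>L\<close>.\<close>

definition coclosed_submodule ::
    "'b set \<Rightarrow> ('a, 'r) ring_scheme \<Rightarrow> ('a, 'b, 'm) right_module_scheme \<Rightarrow> bool" where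
  "coclosed_submodule L R M \<longleftrightarrow>
    right_submodule L R M \<and>
    (\<forall>K. right_submodule K R (M\<lparr>carrier := L\<rparr>) \<and>
       small_submodule (carrier (quotient_module (M\<lparr>carrier := L\<rparr>) K)) R (quotient_module M K) \<longrightarrow>
       K = L)"

text \<open>
  The sum of a (possibly infinite) family of submodules consists of the finite sums of
  elements of its members; the empty family has sum \<open>0\<close>.
\<close>

definition sum_of_submodules ::
    "('a, 'b, 'm) right_module_scheme \<Rightarrow> 'b set set \<Rightarrow> 'b set" where
  "sum_of_submodules M \<S> =
    {finsum M f \<F> | f \<F>. finite \<F> \<and> \<F> \<subseteq> \<S> \<and> (\<forall>A\<in>\<F>. f A \<in> A)}"

definition socle ::
    "('a, 'r) ring_scheme \<Rightarrow> ('a, 'b, 'm) right_module_scheme \<Rightarrow> 'b set" where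
  "socle R M = sum_of_submodules M {A. simple_submodule A R M}"

end

theory Submission
  imports Defs
begin

text \<open>
  A simple submodule of a coclosed submodule \<open>N\<close> is a direct summand of \<open>N\<close> if and only if it is
  one of \<open>M\<close>. One direction is the modular law. For the other, let \<open>N = A \<oplus> K\<close>. As
  \<open>K \<noteq> N\<close>, the submodule \<open>N/K\<close> is not small in \<open>M/K\<close>, so there is a proper submodule
  \<open>X \<supseteq> K\<close> of \<open>M\<close> with \<open>M = N + X = A + X\<close>; since \<open>X\<close> does not contain the simple module
  \<open>A\<close>, the sum is direct. Both implications of the theorem follow, the converse because every
  simple submodule of \<open>M\<close> lies in the socle.
\<close>

section \<open>Sums of subsets and closure properties of submodules\<close>

lemma set_add_carrier_update [simp]: "A <+>\<^bsub>M\<lparr>carrier := N\<rparr>\<^esub> B = A <+>\<^bsub>M\<^esub> B"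
  by (simp add: set_add_def set_mult_def)

lemma mem_set_add_iff: "z \<in> A <+>\<^bsub>M\<^esub> B \<longleftrightarrow> (\<exists>x\<in>A. \<exists>y\<in>B. z = x \<oplus>\<^bsub>M\<^esub> y)"
  by (auto simp: set_add_def set_mult_def)

text \<open>Moves the carrier update outside \<open>add_monoid\<close>, the shape in which the group
  library states its facts on subgroups of a subgroup.\<close>

lemma add_monoid_carrier_update:
  "add_monoid (M\<lparr>carrier := N\<rparr>) = (add_monoid M)\<lparr>carrier := N\<rparr>"
  by simp

lemma right_submodule_subset: "right_submodule H R M \<Longrightarrow> H \<subseteq> carrier M"
  by (metis right_submodule.axioms(1) subgroup.subset partial_object.select_convs(1))

lemma right_submodule_zero: "right_submodule H R M \<Longrightarrow> \<zero>\<^bsub>M\<^esub> \<in> H"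
  by (metis right_submodule.axioms(1) subgroup.one_closed monoid.select_convs(2))

lemma right_submodule_add:
  "right_submodule H R M \<Longrightarrow> x \<in> H \<Longrightarrow> y \<in> H \<Longrightarrow> x \<oplus>\<^bsub>M\<^esub> y \<in> H"
  by (metis right_submodule.axioms(1) subgroup.m_closed monoid.select_convs(1))

lemma right_submodule_minus:
  "right_submodule H R M \<Longrightarrow> x \<in> H \<Longrightarrow> \<ominus>\<^bsub>M\<^esub> x \<in> H"
  by (metis right_submodule.axioms(1) subgroup.m_inv_closed a_inv_def)

context right_module
begin

lemma rsmult_zero_right: "x \<in> carrier M \<Longrightarrow> x \<cdot>\<^bsub>M\<^esub> \<zero> = \<zero>\<^bsub>M\<^esub>"
  by (metis M.add.l_cancel_one R.add.l_one R.zero_closed rsmult_closed rsmult_r_distr)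

lemma rsmult_minus_one:
  assumes "x \<in> carrier M"
  shows "x \<cdot>\<^bsub>M\<^esub> (\<ominus> \<one>) = \<ominus>\<^bsub>M\<^esub> x"
proof -
  have "x \<cdot>\<^bsub>M\<^esub> (\<ominus> \<one>) \<oplus>\<^bsub>M\<^esub> x = x \<cdot>\<^bsub>M\<^esub> (\<ominus> \<one> \<oplus> \<one>)"
    using assms rsmult_r_distr[of x "\<ominus> \<one>" \<one>] by simp
  also have "\<dots> = \<zero>\<^bsub>M\<^esub>"
    using assms by (simp add: R.l_neg rsmult_zero_right)
  finally show ?thesis
    using assms M.minus_equality by auto
qed

text \<open>Closure under negatives comes from the action of \<open>R\<close>: the negative of
  \<open>x\<close> is \<open>x\<close> times \<open>\<ominus> \<one>\<close>.\<close>

lemma right_submoduleI: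
  assumes "H \<subseteq> carrier M" "\<zero>\<^bsub>M\<^esub> \<in> H"
    and "\<And>x y. x \<in> H \<Longrightarrow> y \<in> H \<Longrightarrow> x \<oplus>\<^bsub>M\<^esub> y \<in> H"
    and "\<And>x a. x \<in> H \<Longrightarrow> a \<in> carrier R \<Longrightarrow> x \<cdot>\<^bsub>M\<^esub> a \<in> H"
  shows "right_submodule H R M"
proof -
  have "\<ominus>\<^bsub>M\<^esub> x \<in> H" if "x \<in> H" for x
    using that assms(1) assms(4)[of x "\<ominus> \<one>"] rsmult_minus_one[of x] by auto
  then have "subgroup H (add_monoid M)"
    using assms by (unfold_locales) (auto simp: a_inv_def)
  then show ?thesis
    using assms(4) by (simp add: right_submodule_def right_submodule_axioms_def)
qed

section \<open>Submodules of a submodule, simple submodules and the socle\<close>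

lemma right_submodule_Int:
  "right_submodule H R M \<Longrightarrow> right_submodule K R M \<Longrightarrow> right_submodule (H \<inter> K) R M"
  by (rule right_submoduleI)
    (auto dest: right_submodule_subset right_submodule_zero
      intro: right_submodule_add right_submodule.rsmult_closed)

text \<open>The operations of \<open>N\<close> are those of \<open>M\<close>. Only inverses depend
  on the carrier, and the group library shows that those taken in a subgroup agree with the ambient
  ones.\<close>

lemma right_submodule_restrict_iff:
  assumes "right_submodule N R M"
  shows "right_submodule K R (M\<lparr>carrier := N\<rparr>) \<longleftrightarrow> right_submodule K R M \<and> K \<subseteq> N"
proof -
  have "subgroup N (add_monoid M)"
    using assms by (rule right_submodule.axioms)
  then have "subgroup K (add_monoid (M\<lparr>carrier := N\<rparr>)) \<longleftrightarrow> subgroup K (add_monoid M) \<and> K \<subseteq> N"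
    unfolding add_monoid_carrier_update
    by (metis M.add.incl_subgroup M.add.subgroup_incl subgroup.subset partial_object.update_convs(1)
        partial_object.select_convs(1) partial_object.surjective)
  then show ?thesis
    by (auto simp: right_submodule_def right_submodule_axioms_def)
qed

text \<open>Updating the carrier to \<open>N\<close> and then to \<open>A\<close> is the same as
  updating it to \<open>A\<close>, so simplicity of \<open>A\<close> does not see
  \<open>N\<close>.\<close>

lemma simple_submodule_restrict_iff:
  assumes "right_submodule N R M"
  shows "simple_submodule A R (M\<lparr>carrier := N\<rparr>) \<longleftrightarrow> simple_submodule A R M \<and> A \<subseteq> N"
  using assms by (auto simp: simple_submodule_def right_submodule_restrict_iff)

text \<open>The intersection with \<open>X\<close> is a submodule of the simple module
  \<open>A\<close>, hence zero or all of \<open>A\<close>.\<close>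

lemma simple_submodule_Int_cases:
  assumes "simple_submodule A R M" "right_submodule X R M"
  shows "A \<inter> X = {\<zero>\<^bsub>M\<^esub>} \<or> A \<subseteq> X"
proof -
  have A: "right_submodule A R M"
    using assms by (simp add: simple_submodule_def)
  then have "right_submodule (A \<inter> X) R (M\<lparr>carrier := A\<rparr>)"
    using assms by (simp add: right_submodule_restrict_iff right_submodule_Int)
  then show ?thesis
    using assms(1) by (auto simp: simple_submodule_def simple_right_module_def)
qed

text \<open>Each element of \<open>A\<close> is a finite sum over the one-member family
  \<open>{A}\<close>.\<close>

lemma simple_submodule_subset_socle:
  assumes "simple_submodule A R M"
  shows "A \<subseteq> socle R M"
proof
  fix x assume x: "x \<in> A"
  then have "x \<in> carrier M"
    using assms right_submodule_subset by (auto simp: simple_submodule_def)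
  then have "x = finsum M (\<lambda>_. x) {A}"
    by simp
  with x assms show "x \<in> socle R M"
    unfolding socle_def sum_of_submodules_def by blast
qed

section \<open>The quotient \<open>M/K\<close> and its submodules\<close>

lemma abelian_subgroup_right_submodule:
  "right_submodule K R M \<Longrightarrow> abelian_subgroup K M"
  by (intro abelian_subgroupI3 M.abelian_group_axioms additive_subgroup.intro right_submodule.axioms)

lemma carrier_quotient_module:
  "carrier (quotient_module M K) = {K +>\<^bsub>M\<^esub> x |x. x \<in> carrier M}"
  by (auto simp: quotient_module_def A_RCOSETS_def')

text \<open>A coset of \<open>K\<close> depends only on the addition, so restricting to
  \<open>N\<close> changes just the range of representatives. This gives \<open>N/K\<close>, as it
  occurs in \<open>coclosed_submodule\<close>, the explicit form used below.\<close>

lemma carrier_quotient_module_restrict: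
  "carrier (quotient_module (M\<lparr>carrier := N\<rparr>) K) = {K +>\<^bsub>M\<^esub> x |x. x \<in> N}"
  by (auto simp: quotient_module_def A_RCOSETS_def' a_r_coset_def')

lemma zero_quotient_module: "\<zero>\<^bsub>quotient_module M K\<^esub> = K"
  by (simp add: quotient_module_def)

lemma add_quotient_module:
  assumes "right_submodule K R M" "x \<in> carrier M" "y \<in> carrier M"
  shows "(K +>\<^bsub>M\<^esub> x) \<oplus>\<^bsub>quotient_module M K\<^esub> (K +>\<^bsub>M\<^esub> y) = K +>\<^bsub>M\<^esub> (x \<oplus>\<^bsub>M\<^esub> y)"
  using abelian_subgroup.a_rcos_sum[OF abelian_subgroup_right_submodule] assms
  by (simp add: quotient_module_def)

text \<open>As \<open>K\<close> is stable under \<open>R\<close>, two representatives of a coset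
  have multiples by \<open>a\<close> in the same coset. The union defining the action is therefore a
  union of equal cosets.\<close>

lemma rsmult_quotient_module:
  assumes K: "right_submodule K R M" and x: "x \<in> carrier M" and a: "a \<in> carrier R"
  shows "(K +>\<^bsub>M\<^esub> x) \<cdot>\<^bsub>quotient_module M K\<^esub> a = K +>\<^bsub>M\<^esub> (x \<cdot>\<^bsub>M\<^esub> a)"
proof -
  interpret K: abelian_subgroup K M
    using K by (rule abelian_subgroup_right_submodule)
  have "K +>\<^bsub>M\<^esub> (y \<cdot>\<^bsub>M\<^esub> a) = K +>\<^bsub>M\<^esub> (x \<cdot>\<^bsub>M\<^esub> a)" if y: "y \<in> K +>\<^bsub>M\<^esub> x" for y
  proof -
    obtain k where k: "k \<in> K" "y = k \<oplus>\<^bsub>M\<^esub> x"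
      using y by (auto simp: a_r_coset_def')
    then have "y \<cdot>\<^bsub>M\<^esub> a = k \<cdot>\<^bsub>M\<^esub> a \<oplus>\<^bsub>M\<^esub> x \<cdot>\<^bsub>M\<^esub> a"
      using x a K.a_Hcarr by (simp add: rsmult_l_distr)
    moreover have "k \<cdot>\<^bsub>M\<^esub> a \<in> K"
      using right_submodule.rsmult_closed[OF K k(1) a] .
    ultimately have "y \<cdot>\<^bsub>M\<^esub> a \<in> K +>\<^bsub>M\<^esub> (x \<cdot>\<^bsub>M\<^esub> a)"
      by (auto simp: a_r_coset_def')
    then show ?thesis
      using x a K.a_repr_independence' by (metis rsmult_closed)
  qed
  moreover have "x \<in> K +>\<^bsub>M\<^esub> x"
    using x by (rule K.a_rcos_self)
  ultimately have "(\<Union>y\<in>K +>\<^bsub>M\<^esub> x. K +>\<^bsub>M\<^esub> (y \<cdot>\<^bsub>M\<^esub> a)) = K +>\<^bsub>M\<^esub> (x \<cdot>\<^bsub>M\<^esub> a)"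
    by (intro SUP_eq_const) blast+
  then show ?thesis
    by (simp add: quotient_module_def)
qed

lemma right_submodule_quotient:
  assumes K: "right_submodule K R M" and L: "right_submodule L R M"
  shows "right_submodule {K +>\<^bsub>M\<^esub> x |x. x \<in> L} R (quotient_module M K)" (is "right_submodule ?H _ ?Q")
proof -
  interpret K: abelian_subgroup K M
    using K by (rule abelian_subgroup_right_submodule)
  have LM: "x \<in> carrier M" if "x \<in> L" for x
    using that L right_submodule_subset by auto
  \<comment> \<open>The library's factor group \<open>M A_Mod K\<close> has the same carrier,
    addition and zero as \<open>?Q\<close>, so its inverse formula for cosets carries over.\<close>
  have Q: "inv\<^bsub>add_monoid ?Q\<^esub> X = inv\<^bsub>M A_Mod K\<^esub> X" for X
    by (simp add: m_inv_def quotient_module_def A_FactGroup_def FactGroup_def A_RCOSETS_def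
        set_add_def)
  have minus: "inv\<^bsub>add_monoid ?Q\<^esub> (K +>\<^bsub>M\<^esub> x) = K +>\<^bsub>M\<^esub> (\<ominus>\<^bsub>M\<^esub> x)" if "x \<in> carrier M" for x
  proof -
    have "K +>\<^bsub>M\<^esub> x \<in> carrier (M A_Mod K)"
      using that by (auto simp: A_FactGroup_def FactGroup_def a_r_coset_def RCOSETS_def)
    then show ?thesis
      unfolding Q using that by (simp add: K.a_inv_FactGroup K.a_rcos_inv)
  qed
  have "subgroup ?H (add_monoid ?Q)"
  proof
    show "?H \<subseteq> carrier (add_monoid ?Q)"
      using LM by (auto simp: carrier_quotient_module)
    show "X \<otimes>\<^bsub>add_monoid ?Q\<^esub> Y \<in> ?H" if "X \<in> ?H" "Y \<in> ?H" for X Y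
      using that LM L by (auto simp: add_quotient_module[OF K] intro: right_submodule_add)
    show "\<one>\<^bsub>add_monoid ?Q\<^esub> \<in> ?H"
      using right_submodule_zero[OF L] K.a_subset
      by (auto simp: zero_quotient_module intro!: exI[of _ "\<zero>\<^bsub>M\<^esub>"])
    show "inv\<^bsub>add_monoid ?Q\<^esub> X \<in> ?H" if "X \<in> ?H" for X
      using that LM L minus by (auto intro: right_submodule_minus)
  qed
  moreover have "X \<cdot>\<^bsub>?Q\<^esub> a \<in> ?H" if "X \<in> ?H" "a \<in> carrier R" for X a
    using that LM L
    by (auto simp: rsmult_quotient_module[OF K] intro: right_submodule.rsmult_closed)
  ultimately show ?thesis
    by (simp add: right_submodule_def right_submodule_axioms_def)
qed

text \<open>The projection onto \<open>M/K\<close> respects addition and scalars, so submodules pull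
  back along it.\<close>

lemma right_submodule_quotient_preimage:
  assumes K: "right_submodule K R M" and X: "right_submodule X R (quotient_module M K)"
  shows "right_submodule {x \<in> carrier M. K +>\<^bsub>M\<^esub> x \<in> X} R M"
proof (rule right_submoduleI; clarsimp?)
  have "K +>\<^bsub>M\<^esub> \<zero>\<^bsub>M\<^esub> = K"
    using right_submodule_subset[OF K] by simp
  then show "K +>\<^bsub>M\<^esub> \<zero>\<^bsub>M\<^esub> \<in> X"
    using right_submodule_zero[OF X] by (simp add: zero_quotient_module)
  show "K +>\<^bsub>M\<^esub> (x \<oplus>\<^bsub>M\<^esub> y) \<in> X"
    if "x \<in> carrier M" "K +>\<^bsub>M\<^esub> x \<in> X" "y \<in> carrier M" "K +>\<^bsub>M\<^esub> y \<in> X" for x y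
    using that right_submodule_add[OF X] add_quotient_module[OF K] by metis
  show "K +>\<^bsub>M\<^esub> (x \<cdot>\<^bsub>M\<^esub> a) \<in> X"
    if "x \<in> carrier M" "K +>\<^bsub>M\<^esub> x \<in> X" "a \<in> carrier R" for x a
    using that right_submodule.rsmult_closed[OF X] rsmult_quotient_module[OF K] by metis
qed

text \<open>A failure of smallness in \<open>M/K\<close> has a proper submodule \<open>Y\<close> as
  witness; its preimage \<open>X\<close> in \<open>M\<close> contains \<open>K\<close> and is the
  required submodule.\<close>

lemma not_small_quotientE:
  assumes K: "right_submodule K R M" and L: "right_submodule L R M"
    and not_small: "\<not> small_submodule {K +>\<^bsub>M\<^esub> x |x. x \<in> L} R (quotient_module M K)"
  obtains X where "right_submodule X R M" "K \<subseteq> X" "L <+>\<^bsub>M\<^esub> X = carrier M" "X \<noteq> carrier M"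
proof -
  interpret K: abelian_subgroup K M
    using K by (rule abelian_subgroup_right_submodule)
  let ?Q = "quotient_module M K" and ?H = "{K +>\<^bsub>M\<^esub> x |x. x \<in> L}"
  obtain Y where Y: "right_submodule Y R ?Q" and sum: "?H <+>\<^bsub>?Q\<^esub> Y = carrier ?Q"
    and proper: "Y \<noteq> carrier ?Q"
    using not_small right_submodule_quotient[OF K L] by (auto simp: small_submodule_def)
  define X where "X = {x \<in> carrier M. K +>\<^bsub>M\<^esub> x \<in> Y}"
  have X: "right_submodule X R M"
    unfolding X_def by (rule right_submodule_quotient_preimage[OF K Y])
  have Y_rep: "\<exists>y\<in>X. y' = K +>\<^bsub>M\<^esub> y" if "y' \<in> Y" for y'
    using that right_submodule_subset[OF Y] by (auto simp: carrier_quotient_module X_def)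
  have LM: "x \<in> carrier M" if "x \<in> L" for x
    using that right_submodule_subset[OF L] by auto
  have XM: "x \<in> carrier M" if "x \<in> X" for x
    using that by (simp add: X_def)
  have KX: "K \<subseteq> X"
  proof
    fix k assume k: "k \<in> K"
    then have "K +>\<^bsub>M\<^esub> k = K"
      by (rule K.a_rcos_const)
    then show "k \<in> X"
      using k right_submodule_zero[OF Y] K.a_Hcarr by (simp add: X_def zero_quotient_module)
  qed
  have "m \<in> L <+>\<^bsub>M\<^esub> X" if m: "m \<in> carrier M" for m
  proof -
    have "K +>\<^bsub>M\<^esub> m \<in> ?H <+>\<^bsub>?Q\<^esub> Y"
      unfolding sum using m by (auto simp: carrier_quotient_module)
    then obtain l y' where "l \<in> L" "y' \<in> Y" "K +>\<^bsub>M\<^esub> m = (K +>\<^bsub>M\<^esub> l) \<oplus>\<^bsub>?Q\<^esub> y'"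
      by (auto simp: mem_set_add_iff)
    then obtain l y where ly: "l \<in> L" "y \<in> X"
      and "K +>\<^bsub>M\<^esub> m = (K +>\<^bsub>M\<^esub> l) \<oplus>\<^bsub>?Q\<^esub> (K +>\<^bsub>M\<^esub> y)"
      using Y_rep by blast
    then have "K +>\<^bsub>M\<^esub> m = K +>\<^bsub>M\<^esub> (l \<oplus>\<^bsub>M\<^esub> y)"
      using LM XM by (simp add: add_quotient_module[OF K])
    then have "m \<in> K +>\<^bsub>M\<^esub> (l \<oplus>\<^bsub>M\<^esub> y)"
      using K.a_rcos_self[OF m] by simp
    \<comment> \<open>Equality of cosets determines \<open>m\<close> only up to an element
      \<open>k\<close> of \<open>K\<close>; since \<open>K\<close> lies in \<open>X\<close>, this
      error is absorbed into the summand from \<open>X\<close>.\<close>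
    then obtain k where k: "k \<in> K" "m = k \<oplus>\<^bsub>M\<^esub> (l \<oplus>\<^bsub>M\<^esub> y)"
      by (auto simp: a_r_coset_def')
    then have "m = l \<oplus>\<^bsub>M\<^esub> (k \<oplus>\<^bsub>M\<^esub> y)"
      using LM XM ly K.a_Hcarr by (simp add: M.a_lcomm)
    moreover have "k \<oplus>\<^bsub>M\<^esub> y \<in> X"
      using KX k ly X by (auto intro: right_submodule_add)
    ultimately show ?thesis
      using ly by (auto simp: mem_set_add_iff)
  qed
  then have "L <+>\<^bsub>M\<^esub> X = carrier M"
    using LM XM by (auto simp: mem_set_add_iff)
  moreover have "X \<noteq> carrier M"
  proof
    assume "X = carrier M"
    then have "carrier ?Q \<subseteq> Y"
      by (auto simp: carrier_quotient_module X_def)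
    then show False
      using proper right_submodule_subset[OF Y] by blast
  qed
  ultimately show thesis
    using that X KX by blast
qed

section \<open>Simple direct summands of \<open>N\<close> and of \<open>M\<close>\<close>

lemma direct_summand_restrict:
  assumes N: "right_submodule N R M" and "A \<subseteq> N" and "direct_summand A R M"
  shows "direct_summand A R (M\<lparr>carrier := N\<rparr>)"
proof -
  obtain C where A: "right_submodule A R M" and C: "right_submodule C R M"
    and sum: "A <+>\<^bsub>M\<^esub> C = carrier M" and int: "A \<inter> C = {\<zero>\<^bsub>M\<^esub>}"
    using assms(3) by (auto simp: direct_summand_def)
  \<comment> \<open>This is the modular law: if \<open>x\<close> in \<open>N\<close> is split along
    \<open>A\<close> and \<open>C\<close>, its component in \<open>C\<close> differs from
    \<open>x\<close> by an element of \<open>A\<close>, hence lies in \<open>N\<close>. The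
    complement of \<open>A\<close> in \<open>N\<close> is thus \<open>C \<inter> N\<close>.\<close>
  have "x \<in> A <+>\<^bsub>M\<^esub> (C \<inter> N)" if x: "x \<in> N" for x
  proof -
    have "x \<in> A <+>\<^bsub>M\<^esub> C"
      using sum x right_submodule_subset[OF N] by auto
    then obtain a c where ac: "a \<in> A" "c \<in> C" "x = a \<oplus>\<^bsub>M\<^esub> c"
      by (auto simp: mem_set_add_iff)
    then have "c = \<ominus>\<^bsub>M\<^esub> a \<oplus>\<^bsub>M\<^esub> x"
      using right_submodule_subset[OF A] right_submodule_subset[OF C] by (auto simp: M.r_neg1 subset_iff)
    then have "c \<in> N"
      using ac(1) x \<open>A \<subseteq> N\<close> right_submodule_add[OF N] right_submodule_minus[OF N] by (metis subsetD)
    with ac show ?thesis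
      by (auto simp: mem_set_add_iff)
  qed
  then have "A <+>\<^bsub>M\<^esub> (C \<inter> N) = N"
    using \<open>A \<subseteq> N\<close> by (auto simp: mem_set_add_iff intro!: right_submodule_add[OF N])
  moreover have "A \<inter> (C \<inter> N) = {\<zero>\<^bsub>M\<^esub>}"
    using int right_submodule_zero[OF N] by auto
  moreover have "right_submodule (C \<inter> N) R M"
    using C N by (rule right_submodule_Int)
  ultimately show ?thesis
    using A N \<open>A \<subseteq> N\<close>
    by (auto simp: direct_summand_def right_submodule_restrict_iff intro!: exI[of _ "C \<inter> N"])
qed

lemma direct_summand_coclosed:
  assumes "coclosed_submodule N R M" and A: "simple_submodule A R M"
    and "direct_summand A R (M\<lparr>carrier := N\<rparr>)"
  shows "direct_summand A R M"
proof -
  have N: "right_submodule N R M"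
    using assms(1) by (simp add: coclosed_submodule_def)
  have sub_A: "right_submodule A R M" and "A \<noteq> {\<zero>\<^bsub>M\<^esub>}"
    using A by (auto simp: simple_submodule_def simple_right_module_def)
  obtain K where K: "right_submodule K R M" and "K \<subseteq> N" "A \<subseteq> N"
    and sum: "A <+>\<^bsub>M\<^esub> K = N" and int: "A \<inter> K = {\<zero>\<^bsub>M\<^esub>}"
    using assms(3) N by (auto simp: direct_summand_def right_submodule_restrict_iff)
  \<comment> \<open>If \<open>K\<close> were \<open>N\<close>, then \<open>A\<close> would equal its
    intersection with \<open>K\<close>, which is zero.\<close>
  have "K \<noteq> N"
    using \<open>A \<noteq> {\<zero>\<^bsub>M\<^esub>}\<close> \<open>A \<subseteq> N\<close> int by auto
  then have "\<not> small_submodule {K +>\<^bsub>M\<^esub> x |x. x \<in> N} R (quotient_module M K)"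
    using assms(1) K N \<open>K \<subseteq> N\<close>
    by (auto simp: coclosed_submodule_def carrier_quotient_module_restrict
        right_submodule_restrict_iff)
  then obtain X where X: "right_submodule X R M" and "K \<subseteq> X"
    and NX: "N <+>\<^bsub>M\<^esub> X = carrier M" and proper: "X \<noteq> carrier M"
    using not_small_quotientE[OF K N] by blast
  have AM: "A \<subseteq> carrier M" and KM: "K \<subseteq> carrier M" and XM: "X \<subseteq> carrier M"
    using sub_A K X by (auto dest: right_submodule_subset)
  \<comment> \<open>\<open>A\<close> can replace \<open>N\<close> in the sum because
    \<open>N\<close> is the sum of \<open>A\<close> and \<open>K\<close>, and \<open>K\<close> is
    absorbed by \<open>X\<close>.\<close>
  have "m \<in> A <+>\<^bsub>M\<^esub> X" if "m \<in> carrier M" for m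
  proof -
    have "m \<in> (A <+>\<^bsub>M\<^esub> K) <+>\<^bsub>M\<^esub> X"
      using that NX sum by simp
    then obtain a k x where akx: "a \<in> A" "k \<in> K" "x \<in> X" "m = a \<oplus>\<^bsub>M\<^esub> k \<oplus>\<^bsub>M\<^esub> x"
      by (auto simp: mem_set_add_iff)
    then have "m = a \<oplus>\<^bsub>M\<^esub> (k \<oplus>\<^bsub>M\<^esub> x)"
      using AM KM XM by (auto simp: M.a_assoc subset_iff)
    moreover have "k \<oplus>\<^bsub>M\<^esub> x \<in> X"
      using akx \<open>K \<subseteq> X\<close> by (auto intro!: right_submodule_add[OF X])
    ultimately show ?thesis
      using akx by (auto simp: mem_set_add_iff)
  qed
  then have AX: "A <+>\<^bsub>M\<^esub> X = carrier M"
    using AM XM by (auto simp: mem_set_add_iff intro!: M.a_closed)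
  have "\<not> A \<subseteq> X"
  proof
    assume "A \<subseteq> X"
    then have "A <+>\<^bsub>M\<^esub> X \<subseteq> X"
      by (auto simp: mem_set_add_iff intro!: right_submodule_add[OF X])
    with AX proper XM show False
      by auto
  qed
  then have "A \<inter> X = {\<zero>\<^bsub>M\<^esub>}"
    using simple_submodule_Int_cases[OF A X] by blast
  with AX X sub_A show ?thesis
    by (auto simp: direct_summand_def)
qed

end

theorem lemma6:
  fixes R :: "('a, 'r) ring_scheme"
    and M :: "('a, 'b, 'm) right_module_scheme"
    and N :: "'b set"
  assumes "right_module R M"
    and "coclosed_submodule N R M"
  shows "(simple_direct_injective R M \<longrightarrow> simple_direct_injective R (M\<lparr>carrier := N\<rparr>)) \<and>
    (socle R M \<subseteq> N \<and> simple_direct_injective R (M\<lparr>carrier := N\<rparr>) \<longrightarrow>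
      simple_direct_injective R M)"
proof -
  interpret right_module R M
    by fact
  have N: "right_submodule N R M"
    using assms(2) by (simp add: coclosed_submodule_def)
  have summand_iff: "direct_summand A R (M\<lparr>carrier := N\<rparr>) \<longleftrightarrow> direct_summand A R M"
    if "simple_submodule A R M" "A \<subseteq> N" for A
    using that direct_summand_restrict[OF N] direct_summand_coclosed[OF assms(2)] by blast
  \<comment> \<open>Injectivity of \<open>N\<close> becomes the condition for \<open>M\<close> with
    \<open>A\<close> and \<open>B\<close> confined to \<open>N\<close>; the isomorphisms are
    unaffected, since nested carrier updates collapse.\<close>
  have sdi_iff: "simple_direct_injective R (M\<lparr>carrier := N\<rparr>) \<longleftrightarrow>
    (\<forall>A B. simple_submodule A R M \<and> A \<subseteq> N \<and> simple_submodule B R M \<and> B \<subseteq> N \<and>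
       right_module_iso R (M\<lparr>carrier := A\<rparr>) (M\<lparr>carrier := B\<rparr>) \<noteq> {} \<and> direct_summand B R M \<longrightarrow>
       direct_summand A R M)"
    unfolding simple_direct_injective_def
    using summand_iff by (auto simp: simple_submodule_restrict_iff[OF N])
  show ?thesis
    \<comment> \<open>The first implication only narrows the range of \<open>A\<close> and
      \<open>B\<close>. In the converse, the socle hypothesis puts every simple submodule of
      \<open>M\<close> inside \<open>N\<close>, so the two ranges coincide.\<close>
    unfolding sdi_iff unfolding simple_direct_injective_def
    using simple_submodule_subset_socle subset_trans by meson
qed

end
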